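(* Let $v\ge 2$ be an integer with $\gcd(v,4)\neq 2$ and $\gcd(v,18)\neq 3$. Then there exists an AOA$(1,3,6,v)$.
   Context: An orthogonal array OA$(t,k,v)$ (with $1\le t\le k$) is a $v^t\times k$ array with entries from a set $X$ of size $v$ such that, for every choice of $t$ of its columns, each $t$-tuple in $X^t$ appears exactly once as a row of the corresponding $v^t\times t$ subarray. For integers $1\le s\le t\le k$, an augmented orthogonal array AOA$(s,t,k,v)$ is a $v^t\times(k+1)$ array $A$ such that: (1) the first $k$ columns of $A$ form an OA$(t,k,v)$ on a symbol set $X$ of size $v$; (2) the last column of $A$ has entries from a set $Y$ of size $v^{t-s}$; (3) for any choice of $s$ of the first $k$ columns, these $s$ columns together with the last column contain every $(s+1)$-tuple of $X^s\times Y$ exactly once as a row. *)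

theory Defs
  imports "HOL-Library.FuncSet"
begin

text \<open>An array with N rows and k columns is modelled as a function
  A :: nat => nat => 'a, where A r c is the entry in row r < N, column c < k.
  "Exactly once as a row" is counted with multiplicity over row indices.\<close>

definition is_OA :: "nat \<Rightarrow> nat \<Rightarrow> 'a set \<Rightarrow> (nat \<Rightarrow> nat \<Rightarrow> 'a) \<Rightarrow> bool" where
  "is_OA t k X A \<longleftrightarrow>
     1 \<le> t \<and> t \<le> k \<and> finite X \<and>
     (\<forall>r < card X ^ t. \<forall>c < k. A r c \<in> X) \<and>
     (\<forall>C. C \<subseteq> {..<k} \<and> card C = t \<longrightarrow>
        (\<forall>f \<in> C \<rightarrow>\<^sub>E X. \<exists>!r. r < card X ^ t \<and> (\<forall>c\<in>C. A r c = f c)))"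

definition is_AOA :: "nat \<Rightarrow> nat \<Rightarrow> nat \<Rightarrow> nat \<Rightarrow> 'a set \<Rightarrow> 'b set
                      \<Rightarrow> (nat \<Rightarrow> nat \<Rightarrow> 'a) \<Rightarrow> (nat \<Rightarrow> 'b) \<Rightarrow> bool" where
  "is_AOA s t k v X Y A L \<longleftrightarrow>
     1 \<le> s \<and> s \<le> t \<and> t \<le> k \<and>
     card X = v \<and> finite X \<and> finite Y \<and> card Y = v ^ (t - s) \<and>
     is_OA t k X A \<and>
     (\<forall>r < v ^ t. L r \<in> Y) \<and>
     (\<forall>C. C \<subseteq> {..<k} \<and> card C = s \<longrightarrow>
        (\<forall>f \<in> C \<rightarrow>\<^sub>E X. \<forall>y \<in> Y.
           \<exists>!r. r < v ^ t \<and> (\<forall>c\<in>C. A r c = f c) \<and> L r = y))"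

definition AOA_exists :: "nat \<Rightarrow> nat \<Rightarrow> nat \<Rightarrow> nat \<Rightarrow> bool" where
  "AOA_exists s t k v \<longleftrightarrow>
     (\<exists>(X :: nat set) (Y :: nat set) A L. is_AOA s t k v X Y A L)"

end

theory Submission
  imports Defs "HOL-Algebra.Elementary_Groups" "HOL-Computational_Algebra.Primes"
begin

text \<open>
  Existence is multiplicative in \<open>v\<close>, so it suffices to treat \<open>v\<close> coprime to 6 and
  \<open>v = 4, 8, 9, 27, 12, 24\<close>; the last two cover \<open>v = 3 * 2^a\<close> with \<open>a \<ge> 2\<close>, where the factor 3
  cannot be split off. In an abelian group \<open>G\<close>, written additively, index the rows by
  \<open>(x, y, j)\<close> and take the columns \<open>x\<close>, \<open>x - p j\<close>, \<open>y\<close>, \<open>y - q j\<close>, \<open>x + y + s j\<close>,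
  \<open>x + y + s j + d j\<close>. Two columns with the same leading term determine \<open>j\<close> if \<open>p\<close>, \<open>q\<close>, \<open>d\<close>
  are injective, and three columns with different leading terms determine \<open>j\<close> if adding \<open>p\<close> or
  nothing, and \<open>q\<close> or nothing, to \<open>s\<close> or \<open>s + d\<close> gives injective maps. The last column
  is \<open>(y - \<phi> x, j)\<close> for an endomorphism \<open>\<phi>\<close> such that \<open>\<phi>\<close> and \<open>1 + \<phi>\<close> are injective.
\<close>

section \<open>Arrays from injectivity and counting\<close>

lemma ex1_of_inj_on_card:
  assumes "finite R" "finite S" "card R = card S" "inj_on g R" "g ` R \<subseteq> S" "y \<in> S"
  shows "\<exists>!r. r \<in> R \<and> g r = y"
proof -
  have "g ` R = S"
    using assms by (metis card_image card_subset_eq)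
  then show ?thesis
    using assms by (metis imageE inj_onD)
qed

text \<open>There are exactly as many rows as tuples to be covered, so it is enough that no tuple
  occurs twice. Rows, symbols and labels may come from arbitrary finite sets, because bijections
  carry them to initial segments of the naturals.\<close>

lemma AOA_existsI:
  fixes col :: "'r \<Rightarrow> nat \<Rightarrow> 'a" and lab :: "'r \<Rightarrow> 'b"
  assumes stk: "1 \<le> s" "s \<le> t" "t \<le> k"
    and finX: "finite X" and finY: "finite Y" and finR: "finite R"
    and cards: "card X = v" "card Y = v ^ (t - s)" "card R = v ^ t"
    and col: "\<And>r c. r \<in> R \<Longrightarrow> c < k \<Longrightarrow> col r c \<in> X"
    and lab: "\<And>r. r \<in> R \<Longrightarrow> lab r \<in> Y"
    and inj_t: "\<And>C r r'. C \<subseteq> {..<k} \<Longrightarrow> card C = t \<Longrightarrow> r \<in> R \<Longrightarrow> r' \<in> R \<Longrightarrow>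
        (\<And>c. c \<in> C \<Longrightarrow> col r c = col r' c) \<Longrightarrow> r = r'"
    and inj_s: "\<And>C r r'. C \<subseteq> {..<k} \<Longrightarrow> card C = s \<Longrightarrow> r \<in> R \<Longrightarrow> r' \<in> R \<Longrightarrow>
        (\<And>c. c \<in> C \<Longrightarrow> col r c = col r' c) \<Longrightarrow> lab r = lab r' \<Longrightarrow> r = r'"
  shows "AOA_exists s t k v"
proof -
  obtain eX where eX: "bij_betw eX X {..<v}"
    using ex_bij_betw_finite_nat[OF finX] cards by (auto simp: atLeast0LessThan)
  obtain eY where eY: "bij_betw eY Y {..<v ^ (t - s)}"
    using ex_bij_betw_finite_nat[OF finY] cards by (auto simp: atLeast0LessThan)
  obtain eR where eR: "bij_betw eR {..<v ^ t} R"
    using ex_bij_betw_nat_finite[OF finR] cards by (auto simp: atLeast0LessThan)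
  define A where "A n c = eX (col (eR n) c)" for n c
  define L where "L n = eY (lab (eR n))" for n
  have R: "eR n \<in> R" if "n < v ^ t" for n
    using eR that by (auto simp: bij_betw_def)
  have A: "A n c < v" if "n < v ^ t" "c < k" for n c
    using eX col[OF R[OF that(1)] that(2)] by (auto simp: A_def bij_betw_def)
  have L: "L n < v ^ (t - s)" if "n < v ^ t" for n
    using eY lab[OF R[OF that]] by (auto simp: L_def bij_betw_def)
  have A_eq: "col (eR n) c = col (eR m) c"
    if "n < v ^ t" "m < v ^ t" "c < k" "A n c = A m c" for n m c
    using that eX col[OF R] by (auto simp: A_def bij_betw_def dest: inj_onD)
  have L_eq: "lab (eR n) = lab (eR m)"
    if "n < v ^ t" "m < v ^ t" "L n = L m" for n m
    using that eY lab[OF R] by (auto simp: L_def bij_betw_def dest: inj_onD)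
  have R_eq: "n = m" if "n < v ^ t" "m < v ^ t" "eR n = eR m" for n m
    using that eR by (auto simp: bij_betw_def dest: inj_onD)
  have fin: "finite (C \<rightarrow>\<^sub>E {..<v})" if "C \<subseteq> {..<k}" for C
    using that by (meson finite_PiE finite_lessThan finite_subset)
  have OA: "is_OA t k {..<v} A"
    unfolding is_OA_def
  proof (intro conjI allI impI ballI)
    fix C f assume C: "C \<subseteq> {..<k} \<and> card C = t" and f: "f \<in> C \<rightarrow>\<^sub>E {..<v}"
    \<comment> \<open>Restricting a row to \<open>C\<close> turns it into a point of the extensional
      function space, so that agreement on \<open>C\<close> becomes an equation and the counting
      lemma applies.\<close>
    have "\<exists>!n. n \<in> {..<v ^ t} \<and> restrict (A n) C = f"
    proof (rule ex1_of_inj_on_card[OF _ fin _ _ _ f])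
      show "card {..<v ^ t} = card (C \<rightarrow>\<^sub>E {..<v})"
        using C finite_subset[of C "{..<k}"] by (simp add: card_PiE)
      show "inj_on (\<lambda>n. restrict (A n) C) {..<v ^ t}"
      proof (rule inj_onI)
        fix n m assume nm: "n \<in> {..<v ^ t}" "m \<in> {..<v ^ t}"
          and eq: "restrict (A n) C = restrict (A m) C"
        have "col (eR n) c = col (eR m) c" if "c \<in> C" for c
          using that C nm fun_cong[OF eq, of c] by (intro A_eq) auto
        then show "n = m"
          using inj_t C R R_eq nm by (metis lessThan_iff)
      qed
    qed (use C A in auto)
    then show "\<exists>!n. n < card {..<v} ^ t \<and> (\<forall>c\<in>C. A n c = f c)"
      using f by (simp add: fun_eq_iff restrict_def PiE_def extensional_def) (smt (verit))
  qed (use stk A in auto)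
  have "is_AOA s t k v {..<v} {..<v ^ (t - s)} A L"
    unfolding is_AOA_def
  proof (intro conjI allI impI ballI)
    fix C f y assume C: "C \<subseteq> {..<k} \<and> card C = s" and f: "f \<in> C \<rightarrow>\<^sub>E {..<v}"
      and y: "y \<in> {..<v ^ (t - s)}"
    have "\<exists>!n. n \<in> {..<v ^ t} \<and> (restrict (A n) C, L n) = (f, y)"
    proof (rule ex1_of_inj_on_card[where S = "(C \<rightarrow>\<^sub>E {..<v}) \<times> {..<v ^ (t - s)}"])
      \<comment> \<open>The count is \<open>v ^ s * v ^ (t - s) = v ^ t\<close>, which relies on
        \<open>s \<le> t\<close>.\<close>
      show "card {..<v ^ t} = card ((C \<rightarrow>\<^sub>E {..<v}) \<times> {..<v ^ (t - s)})"
        using C finite_subset[of C "{..<k}"] stk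
        by (simp add: card_PiE card_cartesian_product flip: power_add)
      show "inj_on (\<lambda>n. (restrict (A n) C, L n)) {..<v ^ t}"
      proof (rule inj_onI)
        fix n m assume nm: "n \<in> {..<v ^ t}" "m \<in> {..<v ^ t}"
          and eq: "(restrict (A n) C, L n) = (restrict (A m) C, L m)"
        have "col (eR n) c = col (eR m) c" if "c \<in> C" for c
          using that C nm eq by (intro A_eq) (auto dest: fun_cong[where x = c])
        moreover have "lab (eR n) = lab (eR m)"
          using nm eq by (intro L_eq) auto
        ultimately show "n = m"
          using inj_s C R R_eq nm by (metis lessThan_iff)
      qed
    qed (use C A L f y fin in auto)
    then show "\<exists>!n. n < v ^ t \<and> (\<forall>c\<in>C. A n c = f c) \<and> L n = y"
      using f by (simp add: fun_eq_iff restrict_def PiE_def extensional_def) (smt (verit))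
  qed (use stk OA L in auto)
  then show ?thesis
    unfolding AOA_exists_def by blast
qed

section \<open>Products of augmented orthogonal arrays\<close>

lemma is_OA_row_unique:
  assumes "is_OA t k X A" "C \<subseteq> {..<k}" "card C = t" "n < card X ^ t" "m < card X ^ t"
    and "\<And>c. c \<in> C \<Longrightarrow> A n c = A m c"
  shows "n = m"
proof -
  have "restrict (A n) C \<in> C \<rightarrow>\<^sub>E X"
    using assms by (auto simp: is_OA_def)
  then have "\<exists>!r. r < card X ^ t \<and> (\<forall>c\<in>C. A r c = restrict (A n) C c)"
    using assms unfolding is_OA_def by blast
  then show ?thesis
    using assms by (metis restrict_apply')
qed

lemma is_AOA_row_unique:
  assumes "is_AOA s t k v X Y A L" "C \<subseteq> {..<k}" "card C = s" "n < v ^ t" "m < v ^ t"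
    and "\<And>c. c \<in> C \<Longrightarrow> A n c = A m c" and "L n = L m"
  shows "n = m"
proof -
  have "restrict (A n) C \<in> C \<rightarrow>\<^sub>E X" "L n \<in> Y"
    using assms by (auto simp: is_AOA_def is_OA_def)
  moreover have "\<forall>f \<in> C \<rightarrow>\<^sub>E X. \<forall>y \<in> Y. \<exists>!r. r < v ^ t \<and> (\<forall>c\<in>C. A r c = f c) \<and> L r = y"
    using assms(1-3) by (simp add: is_AOA_def)
  ultimately have "\<exists>!r. r < v ^ t \<and> (\<forall>c\<in>C. A r c = restrict (A n) C c) \<and> L r = L n"
    by blast
  then show ?thesis
    using assms by (metis restrict_apply')
qed

text \<open>Rows of the product are pairs of rows, with entries and labels paired. Agreement of two
  such rows splits into agreement in each factor, where rows are unique.\<close>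

lemma AOA_exists_mult:
  assumes "AOA_exists s t k v" "AOA_exists s t k w"
  shows "AOA_exists s t k (v * w)"
proof -
  obtain X :: "nat set" and Y :: "nat set" and A L where V: "is_AOA s t k v X Y A L"
    using assms(1) unfolding AOA_exists_def by blast
  obtain X' :: "nat set" and Y' :: "nat set" and A' L' where W: "is_AOA s t k w X' Y' A' L'"
    using assms(2) unfolding AOA_exists_def by blast
  have V': "is_OA t k X A" "card X = v" and W': "is_OA t k X' A'" "card X' = w"
    using V W by (auto simp: is_AOA_def)
  show ?thesis
  proof (rule AOA_existsI[where X = "X \<times> X'" and Y = "Y \<times> Y'"
        and R = "{..<v ^ t} \<times> {..<w ^ t}" and col = "\<lambda>(n, m) c. (A n c, A' m c)"
        and lab = "\<lambda>(n, m). (L n, L' m)"])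
    fix C r r' assume C: "C \<subseteq> {..<k}" "card C = t"
      and r: "r \<in> {..<v ^ t} \<times> {..<w ^ t}" "r' \<in> {..<v ^ t} \<times> {..<w ^ t}"
      and eq: "\<And>c. c \<in> C \<Longrightarrow> (case r of (n, m) \<Rightarrow> \<lambda>c. (A n c, A' m c)) c
                              = (case r' of (n, m) \<Rightarrow> \<lambda>c. (A n c, A' m c)) c"
    have "fst r = fst r'" "snd r = snd r'"
      using is_OA_row_unique[OF V'(1) C, of "fst r" "fst r'"]
        is_OA_row_unique[OF W'(1) C, of "snd r" "snd r'"] r eq V'(2) W'(2)
      by (auto split: prod.splits)
    then show "r = r'"
      by (rule prod_eqI)
  next
    fix C r r' assume C: "C \<subseteq> {..<k}" "card C = s"
      and r: "r \<in> {..<v ^ t} \<times> {..<w ^ t}" "r' \<in> {..<v ^ t} \<times> {..<w ^ t}"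
      and eq: "\<And>c. c \<in> C \<Longrightarrow> (case r of (n, m) \<Rightarrow> \<lambda>c. (A n c, A' m c)) c
                              = (case r' of (n, m) \<Rightarrow> \<lambda>c. (A n c, A' m c)) c"
      and lab: "(case r of (n, m) \<Rightarrow> (L n, L' m)) = (case r' of (n, m) \<Rightarrow> (L n, L' m))"
    have "fst r = fst r'" "snd r = snd r'"
      using is_AOA_row_unique[OF V C, of "fst r" "fst r'"]
        is_AOA_row_unique[OF W C, of "snd r" "snd r'"] r eq lab
      by (auto split: prod.splits)
    then show "r = r'"
      by (rule prod_eqI)
  qed (use V W in \<open>auto simp: is_AOA_def is_OA_def card_cartesian_product power_mult_distrib\<close>)
qed

section \<open>Construction over a finite abelian group\<close>

context comm_group
begin

lemma mult_inv_eq_iff: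
  assumes "x \<in> carrier G" "a \<in> carrier G" "z \<in> carrier G"
  shows "x \<otimes> inv a = z \<longleftrightarrow> x = z \<otimes> a"
  using assms by (metis inv_closed inv_solve_right m_closed)

theorem AOA_exists_of_difference_scheme:
  assumes fin: "finite (carrier G)"
    and hom: "\<phi> \<in> hom G G"
    and inj_\<phi>: "inj_on \<phi> (carrier G)" "inj_on (\<lambda>x. x \<otimes> \<phi> x) (carrier G)"
    and closed: "p \<in> carrier G \<rightarrow> carrier G" "q \<in> carrier G \<rightarrow> carrier G"
      "s \<in> carrier G \<rightarrow> carrier G" "d \<in> carrier G \<rightarrow> carrier G"
    and inj: "inj_on p (carrier G)" "inj_on q (carrier G)" "inj_on d (carrier G)"
    and inj3: "\<And>a b c. a \<in> {\<lambda>j. \<one>, p} \<Longrightarrow> b \<in> {\<lambda>j. \<one>, q} \<Longrightarrow> c \<in> {s, \<lambda>j. s j \<otimes> d j} \<Longrightarrow>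
      inj_on (\<lambda>j. a j \<otimes> b j \<otimes> c j) (carrier G)"
  shows "AOA_exists 1 3 6 (order G)"
proof -
  \<comment> \<open>\<open>w c\<close> is the shift of column \<open>c\<close>. Columns with equal
    \<open>c div 2\<close> share the leading term \<open>x\<close>, \<open>y\<close> or
    \<open>x + y\<close>; the shift is subtracted in the first two classes and added in the
    third.\<close>
  define w where "w c = (if c = 0 \<or> c = 2 then (\<lambda>j. \<one>) else if c = 1 then p else if c = 3 then q
    else if c = 4 then s else (\<lambda>j. s j \<otimes> d j))" for c :: nat
  define col where "col = (\<lambda>(x, y, j) c. if c < 2 then x \<otimes> inv w c j
    else if c < 4 then y \<otimes> inv w c j else x \<otimes> y \<otimes> w c j)"
  define lab where "lab = (\<lambda>(x, y, j :: 'a). (y \<otimes> inv \<phi> x, j))"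
  let ?R = "carrier G \<times> carrier G \<times> carrier G"
  have w[simp]: "w c j \<in> carrier G" if "j \<in> carrier G" for c j
    using closed that by (auto simp: w_def)
  have \<phi>[simp]: "\<phi> x \<in> carrier G" if "x \<in> carrier G" for x
    using hom that by (auto simp: hom_def)
  have same_class: "j = j'"
    if in_carrier: "x \<in> carrier G" "y \<in> carrier G" "j \<in> carrier G"
      "x' \<in> carrier G" "y' \<in> carrier G" "j' \<in> carrier G"
    and c: "a < b" "b < 6" "a div 2 = b div 2"
    and eq: "col (x, y, j) a = col (x', y', j') a" "col (x, y, j) b = col (x', y', j') b"
    for x y j x' y' j' a b
  proof -
    have pq: "p j \<in> carrier G" "p j' \<in> carrier G" "q j \<in> carrier G" "q j' \<in> carrier G"
        "s j \<in> carrier G" "s j' \<in> carrier G" "d j \<in> carrier G" "d j' \<in> carrier G"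
      using closed in_carrier by auto
    have "a = 0 \<and> b = 1 \<or> a = 2 \<and> b = 3 \<or> a = 4 \<and> b = 5"
      using c by presburger
    then consider "a = 0" "b = 1" | "a = 2" "b = 3" | "a = 4" "b = 5"
      by blast
    then show ?thesis
    proof cases
      case 1
      then have "inv p j = inv p j'"
        using eq in_carrier pq by (simp add: col_def w_def)
      then have "p j = p j'"
        using pq by (metis inv_inv)
      then show ?thesis using inj(1) in_carrier by (auto dest: inj_onD)
    next
      case 2
      then have "inv q j = inv q j'"
        using eq in_carrier pq by (simp add: col_def w_def)
      then have "q j = q j'"
        using pq by (metis inv_inv)
      then show ?thesis using inj(2) in_carrier by (auto dest: inj_onD)
    next
      case 3
      then have "x \<otimes> y \<otimes> s j = x' \<otimes> y' \<otimes> s j'"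
          "x \<otimes> y \<otimes> (s j \<otimes> d j) = x' \<otimes> y' \<otimes> (s j' \<otimes> d j')"
        using eq by (simp_all add: col_def w_def)
      \<comment> \<open>The two columns of the third class differ exactly by \<open>d j\<close>, so
        cancelling one from the other isolates it.\<close>
      then have "d j = d j'"
        using in_carrier pq by (metis Units_l_cancel Units_eq m_assoc m_closed)
      then show ?thesis using inj(3) in_carrier by (auto dest: inj_onD)
    qed
  qed
  have all_classes: "j = j'"
    if in_carrier: "x \<in> carrier G" "y \<in> carrier G" "j \<in> carrier G"
      "x' \<in> carrier G" "y' \<in> carrier G" "j' \<in> carrier G"
    and c: "a div 2 = 0" "b div 2 = 1" "c div 2 = 2"
    and eq: "col (x, y, j) a = col (x', y', j') a" "col (x, y, j) b = col (x', y', j') b"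
      "col (x, y, j) c = col (x', y', j') c"
    for x y j x' y' j' a b c
  proof -
    \<comment> \<open>Solving the first two columns for \<open>u\<close> and \<open>v\<close> and
      substituting in the third leaves the sum of the three shifts, a function of \<open>i\<close>
      alone.\<close>
    have *: "col (u, v, i) c = (col (u, v, i) a \<otimes> col (u, v, i) b) \<otimes> (w a i \<otimes> w b i \<otimes> w c i)"
      if "u \<in> carrier G" "v \<in> carrier G" "i \<in> carrier G" for u v i
    proof -
      have "a < 2" "\<not> b < 2" "b < 4" "\<not> c < 2" "\<not> c < 4"
        using c by presburger+
      then have col: "col (u, v, i) a = u \<otimes> inv w a i" "col (u, v, i) b = v \<otimes> inv w b i"
          "col (u, v, i) c = u \<otimes> v \<otimes> w c i"
        by (simp_all add: col_def)
      define u' v' where "u' = u \<otimes> inv w a i" and "v' = v \<otimes> inv w b i"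
      have "u = u' \<otimes> w a i" "v = v' \<otimes> w b i" "u' \<in> carrier G" "v' \<in> carrier G"
        using that by (simp_all add: u'_def v'_def m_assoc)
      then show ?thesis
        using that unfolding col u'_def[symmetric] v'_def[symmetric] by (simp add: m_ac)
    qed
    have "col (x, y, j) a \<in> carrier G" "col (x, y, j) b \<in> carrier G"
      using in_carrier by (simp_all add: col_def)
    then have "w a j \<otimes> w b j \<otimes> w c j = w a j' \<otimes> w b j' \<otimes> w c j'"
      using *[of x y j] *[of x' y' j'] in_carrier eq by simp
    moreover have "inj_on (\<lambda>j. w a j \<otimes> w b j \<otimes> w c j) (carrier G)"
    proof (rule inj3)
      have "a = 0 \<or> a = 1" "b = 2 \<or> b = 3" "c = 4 \<or> c = 5"
        using c by presburger+
      then show "w a \<in> {\<lambda>j. \<one>, p}" "w b \<in> {\<lambda>j. \<one>, q}" "w c \<in> {s, \<lambda>j. s j \<otimes> d j}"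
        by (auto simp: w_def)
    qed
    ultimately show ?thesis
      using in_carrier by (auto dest: inj_onD)
  qed
  \<comment> \<open>For a common \<open>j\<close> the shifts cancel, and any two of
    \<open>x\<close>, \<open>y\<close>, \<open>x + y\<close> determine the pair.\<close>
  have two_classes: "x = x' \<and> y = y'"
    if in_carrier: "x \<in> carrier G" "y \<in> carrier G" "j \<in> carrier G"
      "x' \<in> carrier G" "y' \<in> carrier G"
    and c: "a div 2 \<noteq> b div 2" "a < 6" "b < 6"
    and eq: "col (x, y, j) a = col (x', y', j) a" "col (x, y, j) b = col (x', y', j) b"
    for x y j x' y' a b
  proof -
    have "c div 2 = 0 \<and> x = x' \<or> c div 2 = 1 \<and> y = y' \<or> c div 2 = 2 \<and> x \<otimes> y = x' \<otimes> y'"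
      if "col (x, y, j) c = col (x', y', j) c" "c < 6" for c
      using that in_carrier by (auto simp: col_def split: if_splits)
    from this[OF eq(1) c(2)] this[OF eq(2) c(3)] show ?thesis
      using c(1) in_carrier by auto
  qed
  show ?thesis
  proof (rule AOA_existsI[where X = "carrier G" and Y = "carrier G \<times> carrier G"
        and R = ?R and col = col and lab = lab])
    fix C :: "nat set" and r r' assume C: "C \<subseteq> {..<6}" "card C = 3" and R: "r \<in> ?R" "r' \<in> ?R"
      and eq: "\<And>c. c \<in> C \<Longrightarrow> col r c = col r' c"
    obtain x y j x' y' j' where r: "r = (x, y, j)" "r' = (x', y', j')"
      by (metis prod_cases3)
    have in_carrier: "x \<in> carrier G" "y \<in> carrier G" "j \<in> carrier G"
        "x' \<in> carrier G" "y' \<in> carrier G" "j' \<in> carrier G"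
      using R r by auto
    have finC: "finite C"
      using C by (meson finite_lessThan finite_subset)
    \<comment> \<open>Three columns either meet all three classes or contain a full class. Both
      cases fix \<open>j\<close> and supply two columns of different classes, which then fix
      \<open>x\<close> and \<open>y\<close>.\<close>
    have "j = j' \<and> (\<exists>a\<in>C. \<exists>b\<in>C. a div 2 \<noteq> b div 2)"
    proof (cases "inj_on (\<lambda>c. c div 2) C")
      case True
      have "(\<lambda>c. c div 2) ` C \<subseteq> {0, 1, 2}"
        using C by auto
      moreover have "card ((\<lambda>c. c div 2) ` C) = card {0, 1, 2 :: nat}"
        using True C by (simp add: card_image)
      ultimately have "(\<lambda>c. c div 2) ` C = {0, 1, 2}"
        by (intro card_subset_eq) auto
      then obtain a b c where "a \<in> C" "a div 2 = 0" "b \<in> C" "b div 2 = 1" "c \<in> C" "c div 2 = 2"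
        by (metis (no_types, lifting) imageE insertI1 insertI2)
      then show ?thesis
        using all_classes[OF in_carrier, of a b c] eq r by (metis zero_neq_one)
    next
      case False
      then obtain a b where ab: "a \<in> C" "b \<in> C" "a < b" "a div 2 = b div 2"
        by (metis (no_types, lifting) inj_onI linorder_neqE_nat)
      have "\<not> C \<subseteq> {a, b}"
        using C card_mono[of "{a, b}" C] ab by auto
      then obtain c where c: "c \<in> C" "c \<noteq> a" "c \<noteq> b"
        by blast
      \<comment> \<open>A class has only two columns, so the third column of \<open>C\<close> lies
        outside it.\<close>
      have "a div 2 \<noteq> c div 2"
        using c(2,3) ab(3,4) by linarith
      moreover have "j = j'"
        using same_class[OF in_carrier, of a b] ab eq r C by auto
      ultimately show ?thesis
        using ab(1) c(1) by blast
    qed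
    then obtain a b where "j = j'" "a \<in> C" "b \<in> C" "a div 2 \<noteq> b div 2"
      by blast
    then show "r = r'"
      using two_classes[OF in_carrier(1-5), of a b] eq r C by auto
  next
    fix C :: "nat set" and r r' assume C: "C \<subseteq> {..<6}" "card C = 1" and R: "r \<in> ?R" "r' \<in> ?R"
      and eq: "\<And>c. c \<in> C \<Longrightarrow> col r c = col r' c" and lab: "lab r = lab r'"
    obtain x y j x' y' j' where r: "r = (x, y, j)" "r' = (x', y', j')"
      by (metis prod_cases3)
    have in_carrier: "x \<in> carrier G" "y \<in> carrier G" "j \<in> carrier G"
        "x' \<in> carrier G" "y' \<in> carrier G" "j' \<in> carrier G"
      using R r by auto
    obtain c where "c \<in> C"
      using C by (metis card_1_singletonE insertI1)
    have j: "j = j'"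
      using lab r by (simp add: lab_def)
    \<comment> \<open>The label fixes \<open>j\<close> and \<open>u\<close>, and
      \<open>y = u + \<phi> x\<close>. The remaining column therefore reveals \<open>x\<close>,
      \<open>\<phi> x\<close> or \<open>x + \<phi> x\<close> up to known terms, and each of these
      determines \<open>x\<close>.\<close>
    define u where "u = y \<otimes> inv \<phi> x"
    have "u = y' \<otimes> inv \<phi> x'"
      using lab r by (simp add: lab_def u_def)
    then have u: "u \<in> carrier G" "y = u \<otimes> \<phi> x" "y' = u \<otimes> \<phi> x'"
      using in_carrier by (auto simp: u_def mult_inv_eq_iff[symmetric])
    consider "x = x'" | "y = y'" | "x \<otimes> y = x' \<otimes> y'"
      using eq[OF \<open>c \<in> C\<close>] in_carrier j r by (auto simp: col_def split: if_splits)
    then have "x = x'"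
    proof cases
      case 2
      then have "\<phi> x = \<phi> x'"
        using u in_carrier by simp
      then show ?thesis
        using inj_\<phi>(1) in_carrier by (auto dest: inj_onD)
    next
      case 3
      then have "u \<otimes> (x \<otimes> \<phi> x) = u \<otimes> (x' \<otimes> \<phi> x')"
        using u in_carrier by (simp add: m_ac)
      then have "x \<otimes> \<phi> x = x' \<otimes> \<phi> x'"
        using u(1) in_carrier by simp
      then show ?thesis
        using inj_\<phi>(2) in_carrier by (auto dest: inj_onD)
    qed
    then show "r = r'"
      using r j u by simp
  next
    show "card ?R = order G ^ 3"
      by (simp add: card_cartesian_product order_def power3_eq_cube)
    show "card (carrier G \<times> carrier G) = order G ^ (3 - 1)"
      by (simp add: card_cartesian_product order_def power2_eq_square)
    show "col r c \<in> carrier G" if "r \<in> ?R" for r c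
      using that by (auto simp: col_def)
    show "lab r \<in> carrier G \<times> carrier G" if "r \<in> ?R" for r
      using that by (auto simp: lab_def)
  qed (use fin in \<open>auto simp: order_def\<close>)
qed

end

section \<open>Explicit schemes for the small orders\<close>

lemma comm_group_DirProd:
  assumes "comm_group G" "comm_group H"
  shows "comm_group (G \<times>\<times> H)"
proof -
  interpret G: comm_group G by fact
  interpret H: comm_group H by fact
  show ?thesis
    by (rule group.group_comm_groupI[OF DirProd_group[OF G.is_group H.is_group]])
      (auto simp: G.m_comm H.m_comm)
qed

text \<open>An executable form of the hypotheses, with the carrier enumerated by the list \<open>E\<close>.\<close>

definition is_difference_scheme ::
  "'a list \<Rightarrow> ('a \<Rightarrow> 'a \<Rightarrow> 'a) \<Rightarrow> 'a \<Rightarrow> ('a \<Rightarrow> 'a) \<Rightarrow>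
    ('a \<Rightarrow> 'a) \<Rightarrow> ('a \<Rightarrow> 'a) \<Rightarrow> ('a \<Rightarrow> 'a) \<Rightarrow> ('a \<Rightarrow> 'a) \<Rightarrow> bool"
  where "is_difference_scheme E m e \<phi> p q s d \<longleftrightarrow>
    distinct E \<and>
    (\<forall>x\<in>set E. \<forall>y\<in>set E. \<phi> (m x y) = m (\<phi> x) (\<phi> y)) \<and>
    (\<forall>f\<in>set [\<phi>, p, q, s, d]. \<forall>x\<in>set E. f x \<in> set E) \<and>
    (\<forall>f\<in>set [\<phi>, \<lambda>x. m x (\<phi> x), p, q, d]. distinct (map f E)) \<and>
    (\<forall>a\<in>set [\<lambda>j. e, p]. \<forall>b\<in>set [\<lambda>j. e, q]. \<forall>c\<in>set [s, \<lambda>j. m (s j) (d j)].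
      distinct (map (\<lambda>j. m (m (a j) (b j)) (c j)) E))"

lemma AOA_exists_of_is_difference_scheme:
  assumes "comm_group G" and E: "carrier G = set E"
    and scheme: "is_difference_scheme E (monoid.mult G) (one G) \<phi> p q s d" and n: "length E = n"
  shows "AOA_exists 1 3 6 n"
proof -
  interpret comm_group G by fact
  note S = scheme[unfolded is_difference_scheme_def distinct_map]
  have "AOA_exists 1 3 6 (order G)"
  proof (rule AOA_exists_of_difference_scheme[where \<phi> = \<phi> and p = p and q = q and s = s and d = d])
    show "inj_on (\<lambda>j. a j \<otimes>\<^bsub>G\<^esub> b j \<otimes>\<^bsub>G\<^esub> c j) (carrier G)"
      if "a \<in> {\<lambda>j. \<one>\<^bsub>G\<^esub>, p}" "b \<in> {\<lambda>j. \<one>\<^bsub>G\<^esub>, q}" "c \<in> {s, \<lambda>j. s j \<otimes>\<^bsub>G\<^esub> d j}" for a b c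
      using S that unfolding E by auto
  qed (use S in \<open>auto simp: E hom_def\<close>)
  moreover have "order G = length E"
    using S by (simp add: order_def E distinct_card)
  ultimately show ?thesis
    using n by simp
qed

lemma carrier_integer_mod_group_2_3:
  "carrier (integer_mod_group 2) = set [0, 1]" "carrier (integer_mod_group 3) = set [0, 1, 2]"
  by (auto simp: carrier_integer_mod_group)

text \<open>
  For orders 4, 8, 9, 27 the maps are multiplications in the finite field by \<open>1\<close>, \<open>-1\<close> and a root
  of \<open>X^2 + X + 1\<close>, \<open>X^3 + X + 1\<close>, \<open>X^2 + 1\<close>, \<open>X^3 - X + 1\<close>, respectively.
\<close>

lemma AOA_exists_4: "AOA_exists 1 3 6 4"
proof -
  let ?G = "integer_mod_group 2 \<times>\<times> integer_mod_group 2"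
  let ?E = "List.product [0, 1 :: int] [0, 1 :: int]"
  \<comment> \<open>Writing the operation as a concrete function makes the scheme condition a closed
    term that can be evaluated.\<close>
  have mult: "monoid.mult ?G = (\<lambda>(a, b) (a', b'). ((a + a') mod 2, (b + b') mod 2))"
    by (auto simp: fun_eq_iff)
  show ?thesis
  proof (rule AOA_exists_of_is_difference_scheme)
    show "comm_group ?G"
      by (intro comm_group_DirProd abelian_integer_mod_group)
    show "carrier ?G = set ?E"
      by (simp only: carrier_DirProd carrier_integer_mod_group_2_3 set_product)
    \<comment> \<open>Let \<open>r\<close> be the root, acting as \<open>\<phi>\<close> and
      \<open>s\<close>, with \<open>p\<close>, \<open>q\<close>, \<open>d\<close> equal to 1. In
      characteristic 2 every required sum is \<open>r\<close> or \<open>r + 1\<close>, nonzero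
      because \<open>r\<close> is outside the prime field. The scheme for order 8 has the same
      form.\<close>
    show "is_difference_scheme ?E (monoid.mult ?G) (one ?G)
        (\<lambda>(a, b). (b, (a + b) mod 2))
        (\<lambda>x. x) (\<lambda>x. x) (\<lambda>(a, b). (b, (a + b) mod 2)) (\<lambda>x. x)"
      unfolding mult one_DirProd one_integer_mod_group by code_simp
  qed simp
qed

lemma AOA_exists_8: "AOA_exists 1 3 6 8"
proof -
  let ?G = "integer_mod_group 2 \<times>\<times> integer_mod_group 2 \<times>\<times> integer_mod_group 2"
  let ?E = "List.product [0, 1 :: int] (List.product [0, 1 :: int] [0, 1 :: int])"
  have mult: "monoid.mult ?G =
      (\<lambda>(a, b, c) (a', b', c'). ((a + a') mod 2, (b + b') mod 2, (c + c') mod 2))"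
    by (auto simp: fun_eq_iff)
  show ?thesis
  proof (rule AOA_exists_of_is_difference_scheme)
    show "comm_group ?G"
      by (intro comm_group_DirProd abelian_integer_mod_group)
    show "carrier ?G = set ?E"
      by (simp only: carrier_DirProd carrier_integer_mod_group_2_3 set_product)
    show "is_difference_scheme ?E (monoid.mult ?G) (one ?G)
        (\<lambda>(a, b, c). (b, (a + c) mod 2, a))
        (\<lambda>x. x) (\<lambda>x. x) (\<lambda>(a, b, c). (b, (a + c) mod 2, a)) (\<lambda>x. x)"
      unfolding mult one_DirProd one_integer_mod_group by code_simp
  qed simp
qed

lemma AOA_exists_9: "AOA_exists 1 3 6 9"
proof -
  let ?G = "integer_mod_group 3 \<times>\<times> integer_mod_group 3"
  let ?E = "List.product [0, 1, 2 :: int] [0, 1, 2 :: int]"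
  have mult: "monoid.mult ?G = (\<lambda>(a, b) (a', b'). ((a + a') mod 3, (b + b') mod 3))"
    by (auto simp: fun_eq_iff)
  show ?thesis
  proof (rule AOA_exists_of_is_difference_scheme)
    show "comm_group ?G"
      by (intro comm_group_DirProd abelian_integer_mod_group)
    show "carrier ?G = set ?E"
      by (simp only: carrier_DirProd carrier_integer_mod_group_2_3 set_product)
    \<comment> \<open>Here \<open>\<phi> = 1\<close> works, as 2 is invertible modulo 3. With
      \<open>p = 1\<close>, \<open>q = -1\<close> and \<open>s = d = r\<close> for the root
      \<open>r\<close>, one has \<open>s + d = -r\<close>, so every required sum is \<open>r\<close>
      or \<open>-r\<close> plus an element of the prime field, hence nonzero. Order 27 is treated in
      the same way.\<close>
    show "is_difference_scheme ?E (monoid.mult ?G) (one ?G)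
        (\<lambda>x. x)
        (\<lambda>x. x) (\<lambda>(a, b). (- a mod 3, - b mod 3)) (\<lambda>(a, b). (b, - a mod 3)) (\<lambda>(a, b). (b, - a mod 3))"
      unfolding mult one_DirProd one_integer_mod_group by code_simp
  qed simp
qed

lemma AOA_exists_27: "AOA_exists 1 3 6 27"
proof -
  let ?G = "integer_mod_group 3 \<times>\<times> integer_mod_group 3 \<times>\<times> integer_mod_group 3"
  let ?E = "List.product [0, 1, 2 :: int] (List.product [0, 1, 2 :: int] [0, 1, 2 :: int])"
  have mult: "monoid.mult ?G =
      (\<lambda>(a, b, c) (a', b', c'). ((a + a') mod 3, (b + b') mod 3, (c + c') mod 3))"
    by (auto simp: fun_eq_iff)
  show ?thesis
  proof (rule AOA_exists_of_is_difference_scheme)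
    show "comm_group ?G"
      by (intro comm_group_DirProd abelian_integer_mod_group)
    show "carrier ?G = set ?E"
      by (simp only: carrier_DirProd carrier_integer_mod_group_2_3 set_product)
    show "is_difference_scheme ?E (monoid.mult ?G) (one ?G)
        (\<lambda>x. x)
        (\<lambda>x. x) (\<lambda>(a, b, c). (- a mod 3, - b mod 3, - c mod 3))
        (\<lambda>(a, b, c). (b, (a + c) mod 3, - a mod 3)) (\<lambda>(a, b, c). (b, (a + c) mod 3, - a mod 3))"
      unfolding mult one_DirProd one_integer_mod_group by code_simp
  qed simp
qed

text \<open>
  No linear scheme exists for orders 12 and 24, since there is none over the group of order 3.
  The tables were found by computer search; their entries are positions in the
  lexicographic enumeration \<open>?E\<close> of the group.
\<close>

lemma AOA_exists_12: "AOA_exists 1 3 6 12"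
proof -
  let ?G = "integer_mod_group 2 \<times>\<times> integer_mod_group 2 \<times>\<times> integer_mod_group 3"
  let ?E = "List.product [0, 1 :: int] (List.product [0, 1 :: int] [0, 1, 2 :: int])"
  let ?f = "\<lambda>ks x. the (map_of (zip ?E (map (nth ?E) ks)) x)"
  have mult: "monoid.mult ?G =
      (\<lambda>(a, b, z) (a', b', z'). ((a + a') mod 2, (b + b') mod 2, (z + z') mod 3))"
    by (auto simp: fun_eq_iff)
  show ?thesis
  proof (rule AOA_exists_of_is_difference_scheme)
    show "comm_group ?G"
      by (intro comm_group_DirProd abelian_integer_mod_group)
    show "carrier ?G = set ?E"
      by (simp only: carrier_DirProd carrier_integer_mod_group_2_3 set_product)
    \<comment> \<open>\<open>\<phi>\<close> is the map used for order 4 on the 2-part and the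
      identity on the 3-part, so \<open>\<phi>\<close> and \<open>1 + \<phi>\<close> are invertible
      on both. Taking \<open>s\<close> to be the identity is a normalisation: \<open>s\<close> must
      be injective, and all maps may be precomposed with its inverse.\<close>
    show "is_difference_scheme ?E (monoid.mult ?G) (one ?G)
        (\<lambda>(a, b, z). (b, (a + b) mod 2, z))
        (?f [0, 5, 6, 7, 11, 3, 10, 4, 2, 8, 9, 1])
        (?f [0, 4, 6, 8, 11, 5, 9, 3, 2, 7, 10, 1])
        (\<lambda>x. x)
        (?f [0, 1, 6, 2, 7, 11, 9, 3, 4, 10, 5, 8])"
      unfolding mult one_DirProd one_integer_mod_group by code_simp
  qed simp
qed

lemma AOA_exists_24: "AOA_exists 1 3 6 24"
proof -
  let ?G = "integer_mod_group 2 \<times>\<times> integer_mod_group 2 \<times>\<times> integer_mod_group 2 \<times>\<times> integer_mod_group 3"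
  let ?E = "List.product [0, 1 :: int] (List.product [0, 1 :: int] (List.product [0, 1 :: int] [0, 1, 2 :: int]))"
  let ?f = "\<lambda>ks x. the (map_of (zip ?E (map (nth ?E) ks)) x)"
  have mult: "monoid.mult ?G =
      (\<lambda>(a, b, c, z) (a', b', c', z').
        ((a + a') mod 2, (b + b') mod 2, (c + c') mod 2, (z + z') mod 3))"
    by (auto simp: fun_eq_iff)
  show ?thesis
  proof (rule AOA_exists_of_is_difference_scheme)
    show "comm_group ?G"
      by (intro comm_group_DirProd abelian_integer_mod_group)
    show "carrier ?G = set ?E"
      by (simp only: carrier_DirProd carrier_integer_mod_group_2_3 set_product)
    \<comment> \<open>\<open>\<phi>\<close> combines the map used for order 8 with the identity on
      the 3-part; \<open>s\<close> is again normalised to the identity.\<close>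
    show "is_difference_scheme ?E (monoid.mult ?G) (one ?G)
        (\<lambda>(a, b, c, z). (b, (a + c) mod 2, a, z))
        (?f [0, 3, 9, 12, 15, 21, 7, 17, 6, 19, 5, 18, 2, 23, 20, 14, 11, 8, 16, 13, 22, 4, 1, 10])
        (?f [0, 4, 5, 12, 16, 17, 18, 15, 14, 6, 3, 2, 9, 7, 22, 21, 19, 10, 20, 13, 11, 8, 1, 23])
        (\<lambda>x. x)
        (?f [0, 14, 21, 9, 23, 12, 16, 1, 11, 19, 10, 2, 15, 22, 20, 18, 13, 17, 8, 6, 4, 5, 3, 7])"
      unfolding mult one_DirProd one_integer_mod_group by code_simp
  qed simp
qed

section \<open>Orders coprime to 6\<close>

lemma AOA_exists_coprime_6:
  fixes n :: nat
  assumes "coprime n 6"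
  shows "AOA_exists 1 3 6 n"
proof -
  let ?G = "integer_mod_group n"
  interpret comm_group ?G
    by simp
  \<comment> \<open>\<open>integer_mod_group 0\<close> is the infinite group of integers, so zero
    has to be excluded before the carrier is known to be finite.\<close>
  have n: "n > 0"
    using assms by (cases n) auto
  have carrier: "carrier ?G = {0..<int n}"
    using n by (simp add: carrier_integer_mod_group)
  have "coprime (int n) 2" "coprime (int n) 3"
    using assms coprime_mult_right_iff[of n 2 3] by (simp_all flip: coprime_int_iff)
  then have coprime: "coprime (int n) k" if "k \<in> {1, 2, 3, 4, -1, -2, -3, -4}" for k
    using that coprime_mult_right_iff[of "int n" 2 2] by auto
  have inj: "inj_on (\<lambda>x. (k * x) mod int n) {0..<int n}"
    if "k \<in> {1, 2, 3, 4, -1, -2, -3, -4}" for k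
  proof (rule inj_onI)
    fix x y assume xy: "x \<in> {0..<int n}" "y \<in> {0..<int n}" "k * x mod int n = k * y mod int n"
    then have "int n dvd k * (x - y)"
      by (simp add: mod_eq_dvd_iff right_diff_distrib)
    then have "int n dvd x - y"
      using coprime[OF that] coprime_dvd_mult_right_iff by blast
    then have "x mod int n = y mod int n"
      by (simp add: mod_eq_dvd_iff)
    then show "x = y"
      using xy by simp
  qed
  have "AOA_exists 1 3 6 (order ?G)"
  \<comment> \<open>The multipliers are \<open>p = -1\<close>, \<open>q = 1\<close>,
    \<open>s = 2\<close>, \<open>s + d = -2\<close>. The shift sums then have multipliers among 1,
    2, 3 and their negatives, all units modulo \<open>n\<close>, as are
    \<open>1 + \<phi> = 2\<close> and \<open>d = -4\<close>.\<close>
  proof (rule AOA_exists_of_difference_scheme[where \<phi> = "\<lambda>x. x" and p = "\<lambda>x. (-1 * x) mod int n"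
        and q = "\<lambda>x. x" and s = "\<lambda>x. (2 * x) mod int n" and d = "\<lambda>x. (-4 * x) mod int n"])
    show "inj_on (\<lambda>x. x \<otimes>\<^bsub>?G\<^esub> x) (carrier ?G)"
      using inj[of 2] by (simp add: carrier)
    show "inj_on (\<lambda>x. (-1 * x) mod int n) (carrier ?G)" "inj_on (\<lambda>x. (-4 * x) mod int n) (carrier ?G)"
      unfolding carrier by (rule inj, simp)+
    fix a b c
    assume a: "a \<in> {\<lambda>j. \<one>\<^bsub>?G\<^esub>, \<lambda>x. (-1 * x) mod int n}"
      and b: "b \<in> {\<lambda>j. \<one>\<^bsub>?G\<^esub>, \<lambda>x. x}"
      and c: "c \<in> {\<lambda>x. (2 * x) mod int n, \<lambda>x. ((2 * x) mod int n) \<otimes>\<^bsub>?G\<^esub> ((-4 * x) mod int n)}"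
    \<comment> \<open>Each choice of shift is replaced by its multiplier modulo \<open>n\<close>, so
      the eight injectivity conditions reduce to one about \<open>k + l + m\<close>.\<close>
    obtain k where k: "k \<in> {0, -1}" "\<And>x. a x mod int n = k * x mod int n"
      using a that[of 0] that[of "-1"] by auto
    obtain l where l: "l \<in> {0, 1}" "\<And>x. b x mod int n = l * x mod int n"
      using b that[of 0] that[of 1] by auto
    obtain m where m: "m \<in> {2, -2}" "\<And>x. c x mod int n = m * x mod int n"
      using c that[of 2] that[of "-2"] by (auto simp: mod_simps)
    have "((a x + b x) mod int n + c x) mod int n = ((k + l + m) * x) mod int n" for x
      using k(2) l(2) m(2) by (metis mod_add_eq mod_add_left_eq distrib_right)
    moreover have "k + l + m \<in> {1, 2, 3, 4, -1, -2, -3, -4}"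
      using k(1) l(1) m(1) by auto
    ultimately show "inj_on (\<lambda>x. a x \<otimes>\<^bsub>?G\<^esub> b x \<otimes>\<^bsub>?G\<^esub> c x) (carrier ?G)"
      unfolding carrier using inj by simp
  qed (use n in \<open>auto simp: carrier hom_def\<close>)
  then show ?thesis
    by (simp add: order_def carrier)
qed

section \<open>Prime powers and assembly of all orders\<close>

text \<open>Multiplying by \<open>x ^ 2\<close> raises the exponent by 2, so exponents 2 and 3 serve
  as bases for the two parities. The factor \<open>m\<close> is 1 for pure powers of 2 or 3, and is
  3 where the factor 3 must stay attached to a power of 2.\<close>

lemma AOA_exists_mult_power:
  assumes "AOA_exists s t k (x ^ 2)" "AOA_exists s t k (m * x ^ 2)" "AOA_exists s t k (m * x ^ 3)"
    and "n \<ge> 2"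
  shows "AOA_exists s t k (m * x ^ n)"
  using assms(4)
proof (induction n rule: less_induct)
  case (less n)
  show ?case
  proof (cases "n = 2 \<or> n = 3")
    case False
    then have "n - 2 < n" "n - 2 \<ge> 2" and n: "n = (n - 2) + 2"
      using less.prems by auto
    then have "AOA_exists s t k (m * x ^ (n - 2) * x ^ 2)"
      using less.IH assms(1) AOA_exists_mult by blast
    then show ?thesis
      by (subst n) (simp only: power_add mult.assoc)
  qed (use assms in auto)
qed

text \<open>Supplies the exponent 0 for the primes 2 and 3, below the range of the induction on
  exponents.\<close>

lemma AOA_exists_1: "AOA_exists 1 3 6 1"
  by (rule AOA_exists_coprime_6) simp

lemma AOA_exists_power_2:
  assumes "a \<noteq> 1"
  shows "AOA_exists 1 3 6 (2 ^ a)"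
  using AOA_exists_mult_power[of 1 3 6 2 1 a] AOA_exists_1 AOA_exists_4 AOA_exists_8 assms
  by (cases "a = 0") simp_all

lemma AOA_exists_power_3:
  assumes "b \<noteq> 1"
  shows "AOA_exists 1 3 6 (3 ^ b)"
  using AOA_exists_mult_power[of 1 3 6 3 1 b] AOA_exists_1 AOA_exists_9 AOA_exists_27 assms
  by (cases "b = 0") simp_all

lemma AOA_exists_3_times_power_2:
  assumes "a \<ge> 2"
  shows "AOA_exists 1 3 6 (3 * 2 ^ a)"
  using AOA_exists_mult_power[of 1 3 6 2 3 a] AOA_exists_4 AOA_exists_12 AOA_exists_24 assms
  by simp

theorem theorem2p9:
  fixes v :: nat
  assumes "v \<ge> 2" and "gcd v 4 \<noteq> 2" and "gcd v 18 \<noteq> 3"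
  shows "AOA_exists 1 3 6 v"
proof -
  obtain a u where u: "v = 2 ^ a * u" "\<not> 2 dvd u"
    using assms(1) by (auto intro: multiplicity_decompose'[of v 2])
  obtain b w where w: "u = 3 ^ b * w" "\<not> 3 dvd w"
    using u(2) by (cases "u = 0") (auto intro: multiplicity_decompose'[of u 3])
  have v: "v = 2 ^ a * 3 ^ b * w"
    using u(1) w(1) by simp
  have "coprime w 2"
    using u(2) w(1) by auto
  moreover have "prime (3 :: nat)"
    by simp
  then have "coprime w 3"
    using w(2) prime_imp_coprime coprime_commute by blast
  ultimately have w6: "coprime w 6"
    using coprime_mult_right_iff[of w 2 3] by simp
  \<comment> \<open>The condition on \<open>gcd v 4\<close> says precisely that 2 does not divide
    \<open>v\<close> exactly once.\<close>
  have a: "a \<noteq> 1"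
  proof
    assume "a = 1"
    then have "gcd v 4 = 2 * gcd u 2"
      using u(1) gcd_mult_distrib_nat[of 2 u 2] by simp
    also have "gcd u 2 = 1"
      using u(2) by (simp add: coprime_iff_gcd_eq_1[symmetric])
    finally show False
      using assms(2) by simp
  qed
  \<comment> \<open>The condition on \<open>gcd v 18\<close> rules out an odd \<open>v\<close>
    divisible by 3 exactly once. Together with \<open>a \<noteq> 1\<close> this gives
    \<open>a \<ge> 2\<close> whenever \<open>b = 1\<close>, as needed to absorb the single factor 3
    into \<open>3 * 2 ^ a\<close>.\<close>
  have ab: "a \<noteq> 0" if "b = 1"
  proof
    assume "a = 0"
    then have "gcd v 18 = 3 * gcd w 6"
      using v that gcd_mult_distrib_nat[of 3 w 6] by simp
    then show False
      using assms(3) w6 by (simp add: coprime_iff_gcd_eq_1)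
  qed
  have "AOA_exists 1 3 6 (2 ^ a * 3 ^ b)"
  proof (cases "b = 1")
    case True
    then show ?thesis
      using AOA_exists_3_times_power_2[of a] a ab by (simp add: mult.commute)
  next
    case False
    then show ?thesis
      using AOA_exists_mult AOA_exists_power_2[OF a] AOA_exists_power_3 by blast
  qed
  then show ?thesis
    unfolding v using AOA_exists_mult AOA_exists_coprime_6[OF w6] by blast
qed

end
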